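(* Let $f:K\to\mathbb{F}_2$ be defined by $f(\lambda u)=tr(\lambda g(u))$ for all $\lambda\in F$, $u\in S$, where $g:S\to F$ is a function. Then the following are equivalent: (1) $f$ is bent; (2) the set $\mathcal{O}=\{L(u,g(u)) : u\in S\}$ is a line oval in $K$. In this case the dual of $f$ is $\tilde f(x)=1+\chi_{E(\mathcal{O})}(x)$, i.e. $\tilde f(x)=0$ if $x\in E(\mathcal{O})$ and $\tilde f(x)=1$ if $x\notin E(\mathcal{O})$. Moreover, every line oval $\mathcal{O}$ in $K$ can be written as $\mathcal{O}=\{L(u,g(u)):u\in S\}$ for some function $g:S\to F$, and the function $f$ defined from this $g$ by $f(\lambda u)=tr(\lambda g(u))$ is bent (and its restriction to each set $uF$, $u\in S$, is $\mathbb{F}_2$-linear).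
   Context: Let $m\ge1$, $q=2^m$, $F=\mathbb{F}_{q}$ viewed as a subfield of $K=\mathbb{F}_{q^2}$. For $x\in K$ put $\bar x=x^q$ and $T(x)=x+\bar x\in F$. Let $tr:F\to\mathbb{F}_2$ and $Tr:K\to\mathbb{F}_2$ be the absolute trace maps. Let $S=\{u\in K: u\bar u=1\}$; every nonzero $x\in K$ is uniquely $x=\lambda u$ with $\lambda\in F^*$, $u\in S$. $K$ is regarded as the affine plane $AG(2,q)$ (a 2-dimensional $F$-vector space); its lines are exactly the sets $L(u,\mu)=\{x\in K: T(ux)+\mu=0\}$, $u\in S$, $\mu\in F$, and $L(u,\mu),L(u,\mu')$ are parallel. A line oval in $K$ is a set of $q+1$ lines of $AG(2,q)$, no two of which are parallel and no three of which pass through a common point (equivalently, these lines extended to $PG(2,q)$ form a line oval whose nucleus is the line at infinity). For a line oval $\mathcal{O}$, $E(\mathcal{O})$ denotes the set of points of $K$ lying on at least one line of $\mathcal{O}$, and $\chi_{E(\mathcal{O})}$ its characteristic function. A function $f:K\to\mathbb{F}_2$ is bent if $W_f(b)=\sum_{x\in K}(-1)^{f(x)+Tr(bx)}=\pm q$ for all $b\in K$; its dual $\tilde f$ is defined by $W_f(b)=(-1)^{\tilde f(b)}q$. *)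

theory Defs
  imports Complex_Main "HOL-Library.FuncSet" "HOL-Library.Indicator_Function" "HOL-Library.Z2" "HOL-Library.Cardinality"
begin

text \<open>
  Throughout, \<open>K\<close> is a finite field given as a type \<open>'a\<close> with \<open>CARD('a) = (2 ^ m)\<^sup>2\<close>, and
  \<open>q = 2 ^ m\<close>. The field with two elements is the type \<^typ>\<open>bit\<close>.
\<close>

text \<open>The elements fixed by \<open>x \<mapsto> x\<^sup>q\<close> are the unique subfield of order \<open>q\<close>.\<close>

definition subF :: "nat \<Rightarrow> 'a::{field,finite} set" where
  "subF m = {x. x ^ (2 ^ m) = x}"

definition conj_q :: "nat \<Rightarrow> 'a::{field,finite} \<Rightarrow> 'a" where
  "conj_q m x = x ^ (2 ^ m)"

definition T :: "nat \<Rightarrow> 'a::{field,finite} \<Rightarrow> 'a" where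
  "T m x = x + conj_q m x"

definition unitS :: "nat \<Rightarrow> 'a::{field,finite} set" where
  "unitS m = {u. u * conj_q m u = 1}"

definition of_F2 :: "bit \<Rightarrow> 'a::{field,finite}" where
  "of_F2 c = (if c = 0 then 0 else 1)"

text \<open>
  Absolute trace of an element \<open>x\<close> of the field of order \<open>2 ^ n\<close>: the sum of the conjugates of \<open>x\<close>
  lies in the prime field and is read there as an element of \<^typ>\<open>bit\<close>. The value is
  meaningful only if \<open>x ^ (2 ^ n) = x\<close>. The map \<open>tr\<close> on \<open>F\<close> is \<open>abs_trace m\<close>, and
  \<open>Tr\<close> on \<open>K\<close> is \<open>abs_trace (2 * m)\<close>.
\<close>

definition abs_trace :: "nat \<Rightarrow> 'a::{field,finite} \<Rightarrow> bit" where
  "abs_trace n x = (THE c. of_F2 c = (\<Sum>i<n. x ^ (2 ^ i)))"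

definition lineL :: "nat \<Rightarrow> 'a::{field,finite} \<Rightarrow> 'a \<Rightarrow> 'a set" where
  "lineL m u \<mu> = {x. T m (u * x) + \<mu> = 0}"

text \<open>Lines of \<open>AG(2,q)\<close>: the translates of the one-dimensional \<open>F\<close>-subspaces of \<open>K\<close>.\<close>

definition ag_lines :: "nat \<Rightarrow> 'a::{field,finite} set set" where
  "ag_lines m = {l. \<exists>a d. d \<noteq> 0 \<and> l = {a + t * d | t. t \<in> subF m}}"

definition parallel :: "'a set \<Rightarrow> 'a set \<Rightarrow> bool" where
  "parallel l l' \<longleftrightarrow> l = l' \<or> l \<inter> l' = {}"

definition line_oval :: "nat \<Rightarrow> 'a::{field,finite} set set \<Rightarrow> bool" where
  "line_oval m Ov \<longleftrightarrow>
     Ov \<subseteq> ag_lines m \<and> card Ov = 2 ^ m + 1 \<and>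
     (\<forall>l\<in>Ov. \<forall>l'\<in>Ov. l \<noteq> l' \<longrightarrow> \<not> parallel l l') \<and>
     (\<forall>l1\<in>Ov. \<forall>l2\<in>Ov. \<forall>l3\<in>Ov.
        l1 \<noteq> l2 \<and> l1 \<noteq> l3 \<and> l2 \<noteq> l3 \<longrightarrow> \<not> (\<exists>x. x \<in> l1 \<and> x \<in> l2 \<and> x \<in> l3))"

definition covered :: "'a set set \<Rightarrow> 'a set" where
  "covered Ov = {x. \<exists>l\<in>Ov. x \<in> l}"

definition sign_of :: "bit \<Rightarrow> int" where
  "sign_of c = (if c = 0 then 1 else - 1)"

definition walsh :: "nat \<Rightarrow> ('a::{field,finite} \<Rightarrow> bit) \<Rightarrow> 'a \<Rightarrow> int" where
  "walsh m f b = (\<Sum>x\<in>UNIV. sign_of (f x + abs_trace (2 * m) (b * x)))"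

definition bent :: "nat \<Rightarrow> ('a::{field,finite} \<Rightarrow> bit) \<Rightarrow> bool" where
  "bent m f \<longleftrightarrow> (\<forall>b. walsh m f b = 2 ^ m \<or> walsh m f b = - (2 ^ m))"

text \<open>Meaningful only for bent functions, where the value is uniquely determined.\<close>

definition dual :: "nat \<Rightarrow> ('a::{field,finite} \<Rightarrow> bit) \<Rightarrow> 'a \<Rightarrow> bit" where
  "dual m f b = (THE c. walsh m f b = sign_of c * 2 ^ m)"

text \<open>
  The function \<open>f\<close> is the one defined from \<open>g\<close> by \<open>f (t u) = tr (t g(u))\<close>. Since every nonzero
  element is uniquely \<open>t u\<close>, and \<open>t = 0\<close> forces \<open>f 0 = 0\<close>, this determines \<open>f\<close>.
\<close>

definition defined_from ::
  "nat \<Rightarrow> ('a::{field,finite} \<Rightarrow> 'a) \<Rightarrow> ('a \<Rightarrow> bit) \<Rightarrow> bool" where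
  "defined_from m g f \<longleftrightarrow> (\<forall>t\<in>subF m. \<forall>u\<in>unitS m. f (t * u) = abs_trace m (t * g u))"

definition F2_linear_on :: "'a::{field,finite} set \<Rightarrow> ('a \<Rightarrow> bit) \<Rightarrow> bool" where
  "F2_linear_on V f \<longleftrightarrow>
     (\<forall>x\<in>V. \<forall>y\<in>V. f (x + y) = f x + f y) \<and> (\<forall>c. \<forall>x\<in>V. f (of_F2 c * x) = c * f x)"

end

theory Submission
  imports Defs "HOL-Computational_Algebra.Primes" "HOL-Computational_Algebra.Polynomial"
begin

text \<open>
  Splitting the Walsh sum along the polar decomposition \<open>x = t u\<close> and summing the additive
  characters of \<open>F\<close> gives \<open>W\<^sub>f(b) = q (N(b) - 1)\<close>, where \<open>N(b)\<close> is the number of \<open>u \<in> S\<close> with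
  \<open>b \<in> L(u, g(u))\<close>. So \<open>f\<close> is bent iff \<open>N\<close> takes only the values 0 and 2. As lines with
  different \<open>u\<close> meet in exactly one point, this says that no three of the lines are concurrent,
  and the value 1 is excluded by counting the intersection points on one line of the oval.
\<close>

subsection \<open>Finite fields\<close>

text \<open>Multiplication by \<open>x\<close> permutes the nonzero elements.\<close>

lemma prod_nonzero_mult:
  fixes x :: "'a::{field,finite}"
  assumes "x \<noteq> 0"
  shows "(\<Prod>y\<in>-{0}. x * y) = \<Prod>(-{0})"
  by (rule prod.reindex_bij_witness[of _ "\<lambda>y. y / x" "\<lambda>y. x * y"]) (use assms in auto)

text \<open>Fermat's argument: the product of all nonzero elements is unchanged when each factor is
  multiplied by \<open>x\<close>, and it can be cancelled.\<close>

lemma power_CARD_eq_same: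
  fixes x :: "'a::{field,finite}"
  shows "x ^ CARD('a) = x"
proof (cases "x = 0")
  case False
  have "x ^ card (-{0::'a}) * \<Prod>(-{0}) = \<Prod>(-{0})"
    using prod_nonzero_mult[OF False] by (simp add: prod.distrib)
  moreover have "\<Prod>(-{0::'a}) \<noteq> 0" by simp
  ultimately have "x ^ card (-{0::'a}) = 1" by simp
  moreover have "CARD('a) = Suc (card (-{0::'a}))"
    using card.remove[of UNIV "0::'a"] by (simp add: Compl_eq_Diff_UNIV)
  ultimately show ?thesis by simp
qed simp

text \<open>Translation by 1 permutes the field, so adding 1 to every element leaves the sum of all
  elements unchanged.\<close>

lemma of_nat_CARD_eq_0: "of_nat CARD('a) = (0 :: 'a::{field,finite})"
proof -
  have "(\<Sum>x\<in>UNIV. x + 1) = (\<Sum>x\<in>UNIV. x :: 'a)"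
    by (rule sum.reindex_bij_witness[of _ "\<lambda>x. x - 1" "\<lambda>x. x + 1"]) auto
  then show ?thesis by (simp add: sum.distrib)
qed

lemma of_F2_inject [simp]: "of_F2 a = (of_F2 b :: 'a::{field,finite}) \<longleftrightarrow> a = b"
  by (cases a; cases b) (simp_all add: of_F2_def)

lemma of_F2_0 [simp]: "of_F2 0 = 0"
  and of_F2_1 [simp]: "of_F2 1 = 1"
  by (simp_all add: of_F2_def)

lemma sign_of_simps [simp]: "sign_of 0 = 1" "sign_of 1 = -1"
  by (simp_all add: sign_of_def)

lemma sign_of_add: "sign_of (a + b) = sign_of a * sign_of b"
  by (cases a; cases b) (simp_all add: sign_of_def)

lemma sum_lessThan_add:
  fixes h :: "nat \<Rightarrow> 'b::comm_monoid_add"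
  shows "sum h {..<m + n} = sum h {..<m} + (\<Sum>i<n. h (m + i))"
  by (induction n) (simp_all add: add.assoc)

lemma line_ovalI:
  assumes "Ov \<subseteq> ag_lines m" "card Ov = 2 ^ m + 1"
    and "\<And>l l'. l \<in> Ov \<Longrightarrow> l' \<in> Ov \<Longrightarrow> l \<noteq> l' \<Longrightarrow> \<not> parallel l l'"
    and "\<And>l1 l2 l3 x. l1 \<in> Ov \<Longrightarrow> l2 \<in> Ov \<Longrightarrow> l3 \<in> Ov \<Longrightarrow>
      l1 \<noteq> l2 \<Longrightarrow> l1 \<noteq> l3 \<Longrightarrow> l2 \<noteq> l3 \<Longrightarrow> x \<in> l1 \<Longrightarrow> x \<in> l2 \<Longrightarrow> x \<in> l3 \<Longrightarrow> False"
  shows "line_oval m Ov"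
  unfolding line_oval_def using assms by blast

context
  fixes m :: nat
  assumes m_pos: "m \<ge> 1" and card_K: "CARD('a::{field,finite}) = (2 ^ m)\<^sup>2"
begin

section \<open>Characteristic 2 and the involution x -> x^q\<close>

lemma CHAR_eq_2: "CHAR('a) = 2"
proof -
  have p: "prime CHAR('a)"
    by (intro prime_CHAR_semidom finite_imp_CHAR_pos) simp
  have "CHAR('a) dvd 2 ^ (2 * m)"
    using of_nat_CARD_eq_0[where 'a='a] card_K of_nat_eq_0_iff_char_dvd[where 'a='a]
    by (metis power_mult mult.commute)
  then have "CHAR('a) dvd 2" using p prime_dvd_power by blast
  then show ?thesis using p by (simp add: primes_dvd_imp_eq two_is_prime_nat)
qed

lemma add_self [simp]: "x + x = (0::'a)"
  using minus_CHAR_2[OF CHAR_eq_2, of x x] by simp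

lemma add_eq_0_iff_eq: "x + y = 0 \<longleftrightarrow> x = (y::'a)"
  using minus_CHAR_2[OF CHAR_eq_2, of x y] by (metis eq_iff_diff_eq_0)

lemma power_2_power_add: "(x + y) ^ (2 ^ n) = x ^ (2 ^ n) + (y::'a) ^ (2 ^ n)"
  by (rule freshmans_dream') (simp_all add: CHAR_eq_2)

text \<open>By additivity, equal powers give (x + y)^(2^n) = 0, hence x + y = 0, which in
  characteristic 2 is x = y.\<close>

lemma power_2_power_inject: "x ^ (2 ^ n) = y ^ (2 ^ n) \<longleftrightarrow> x = (y::'a)"
  using power_2_power_add[of x y n] by (auto simp: add_eq_0_iff_eq)

lemma conj_q_add: "conj_q m (x + y) = conj_q m x + conj_q m (y::'a)"
  by (simp add: conj_q_def power_2_power_add)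

lemma conj_q_mult: "conj_q m (x * y) = conj_q m x * conj_q m (y::'a)"
  by (simp add: conj_q_def power_mult_distrib)

lemma conj_q_conj_q [simp]: "conj_q m (conj_q m x) = (x::'a)"
  using power_CARD_eq_same[of x] by (simp add: conj_q_def card_K power2_eq_square power_mult)

section \<open>The subfield F and the relative trace T\<close>

lemma subF_iff: "x \<in> subF m \<longleftrightarrow> conj_q m x = (x::'a)"
  by (simp add: subF_def conj_q_def)

lemma zero_in_subF [simp]: "(0::'a) \<in> subF m"
  and one_in_subF [simp]: "(1::'a) \<in> subF m"
  by (simp_all add: subF_def)

lemma subF_add: "x \<in> subF m \<Longrightarrow> y \<in> subF m \<Longrightarrow> x + y \<in> (subF m :: 'a set)"
  by (simp add: subF_iff conj_q_add)

lemma subF_mult: "x \<in> subF m \<Longrightarrow> y \<in> subF m \<Longrightarrow> x * y \<in> (subF m :: 'a set)"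
  by (simp add: subF_iff conj_q_mult)

lemma subF_divide: "x \<in> subF m \<Longrightarrow> y \<in> subF m \<Longrightarrow> x / y \<in> (subF m :: 'a set)"
  by (simp add: subF_def power_divide)

lemma subF_power: "x \<in> subF m \<Longrightarrow> x ^ n \<in> (subF m :: 'a set)"
  by (induction n) (simp_all add: subF_mult)

lemma T_add: "T m (x + y) = T m x + T m (y::'a)"
  by (simp add: T_def conj_q_add)

lemma T_mult_subF: "t \<in> subF m \<Longrightarrow> T m (t * x) = t * T m (x::'a)"
  by (simp add: T_def conj_q_mult subF_iff distrib_left)

lemma T_in_subF: "T m (x::'a) \<in> subF m"
  by (simp add: T_def subF_iff conj_q_add add.commute)

text \<open>In characteristic 2, x + x^q = 0 says x^q = x. Thus F is both the kernel of T and, by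
  \<open>range_T\<close>, its image.\<close>

lemma T_eq_0_iff: "T m x = 0 \<longleftrightarrow> (x::'a) \<in> subF m"
  by (auto simp: T_def subF_iff add_eq_0_iff_eq)

text \<open>F is the root set of X^q - X, a nonzero polynomial of degree at most q because q >
  1.\<close>

lemma card_subF_le: "card (subF m :: 'a set) \<le> 2 ^ m"
proof -
  let ?p = "monom 1 (2 ^ m) - monom 1 1 :: 'a poly"
  have m1: "(2::nat) ^ m > 1" using m_pos by (intro one_less_power) auto
  have "coeff ?p (2 ^ m) = 1" using m1 by simp
  then have "?p \<noteq> 0" by (metis coeff_0 zero_neq_one)
  then have "card {x. poly ?p x = 0} \<le> degree ?p" by (rule card_poly_roots_bound)
  also have "\<dots> \<le> 2 ^ m"
    using m1 by (intro degree_diff_le) (simp_all add: degree_monom_eq)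
  also have "{x. poly ?p x = 0} = subF m" by (auto simp: poly_monom subF_def)
  finally show ?thesis .
qed

lemma T_fibre: "{x. T m x = T m a} = (+) a ` (subF m :: 'a set)"
proof (intro set_eqI iffI)
  fix x assume "x \<in> {x. T m x = T m a}"
  then have "a + x \<in> subF m" by (simp add: T_add flip: T_eq_0_iff)
  moreover have "x = a + (a + x)" by (simp flip: add.assoc)
  ultimately show "x \<in> (+) a ` subF m" by (rule rev_image_eqI)
qed (auto simp: T_add T_eq_0_iff[THEN iffD2])

text \<open>K is the union of the fibres of T, and each fibre is a coset of the kernel F.\<close>

lemma card_K_le: "CARD('a) \<le> card (range (T m :: 'a \<Rightarrow> 'a)) * card (subF m :: 'a set)"
proof -
  have "UNIV = (\<Union>y\<in>range (T m :: 'a \<Rightarrow> 'a). {x. T m x = y})" by auto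
  then have "CARD('a) \<le> (\<Sum>y\<in>range (T m :: 'a \<Rightarrow> 'a). card {x. T m x = y})"
    using card_UN_le[of "range (T m :: 'a \<Rightarrow> 'a)" "\<lambda>y. {x. T m x = y}"] by simp
  also have "\<dots> = (\<Sum>y\<in>range (T m :: 'a \<Rightarrow> 'a). card (subF m :: 'a set))"
    by (intro sum.cong refl) (auto simp: T_fibre card_image)
  finally show ?thesis by simp
qed

lemma card_range_T_le: "card (range (T m :: 'a \<Rightarrow> 'a)) \<le> card (subF m :: 'a set)"
  by (intro card_mono) (auto simp: T_in_subF)

text \<open>The image of T lies in its kernel F, so counting fibres gives q^2 \<le> |F|^2; the root
  count gives the other bound.\<close>

lemma card_subF: "card (subF m :: 'a set) = 2 ^ m"
proof -
  have "(2 ^ m)\<^sup>2 \<le> (card (subF m :: 'a set))\<^sup>2"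
    using card_K_le card_range_T_le card_K
    by (metis le_trans mult_le_mono1 power2_eq_square)
  then show ?thesis using card_subF_le by (simp add: power2_nat_le_eq_le)
qed

lemma range_T: "range (T m) = (subF m :: 'a set)"
proof (rule card_seteq)
  have "2 ^ m * 2 ^ m \<le> card (range (T m :: 'a \<Rightarrow> 'a)) * 2 ^ m"
    using card_K_le by (simp add: card_K card_subF power2_eq_square)
  then show "card (subF m :: 'a set) \<le> card (range (T m :: 'a \<Rightarrow> 'a))"
    by (simp add: card_subF)
qed (auto simp: T_in_subF)

section \<open>Polar decomposition of K\<close>

text \<open>The square root of \<open>x x\<^sup>q\<close> in \<open>F\<close>, as \<open>t \<mapsto> t ^ 2 ^ (m - 1)\<close> inverts squaring there.\<close>

definition polar_radius :: "'a \<Rightarrow> 'a" where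
  "polar_radius x = (x * conj_q m x) ^ (2 ^ (m - 1))"

lemma polar_radius_in_subF: "polar_radius x \<in> subF m"
  unfolding polar_radius_def
  by (rule subF_power) (simp add: subF_iff conj_q_mult mult.commute)

lemma power_half_q_square: "t \<in> subF m \<Longrightarrow> (t ^ (2 ^ (m - 1)))\<^sup>2 = (t::'a)"
  using m_pos by (simp add: subF_def flip: power_mult power_Suc2)

lemma polar_radius_square: "(polar_radius x)\<^sup>2 = x * conj_q m x"
  unfolding polar_radius_def
  by (rule power_half_q_square) (simp add: subF_iff conj_q_mult mult.commute)

text \<open>The norm of \<open>t * u\<close> is t^2, and squaring is injective in characteristic
  2.\<close>

lemma polar_radius_mult:
  assumes "t \<in> subF m" "u \<in> unitS m"
  shows "polar_radius (t * u) = t"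
proof -
  have "(polar_radius (t * u))\<^sup>2 = t * conj_q m t * (u * conj_q m u)"
    by (simp only: polar_radius_square conj_q_mult mult.assoc mult.left_commute)
  then have "(polar_radius (t * u)) ^ (2 ^ 1) = t ^ (2 ^ 1)"
    using assms by (simp add: subF_iff unitS_def power2_eq_square)
  then show ?thesis by (simp only: power_2_power_inject)
qed

lemma polar_radius_eq_0_iff [simp]: "polar_radius x = 0 \<longleftrightarrow> x = 0"
  by (simp add: polar_radius_def conj_q_def)

lemma polar_angle_in_unitS: "x \<noteq> 0 \<Longrightarrow> x / polar_radius x \<in> unitS m"
  using polar_radius_in_subF[of x] polar_radius_square[of x]
  by (simp add: unitS_def conj_q_def power_divide subF_def power2_eq_square)

lemma one_in_unitS [simp]: "(1::'a) \<in> unitS m"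
  by (simp add: unitS_def conj_q_def)

lemma unitS_nonzero: "u \<in> unitS m \<Longrightarrow> u \<noteq> (0::'a)"
  by (auto simp: unitS_def)

lemma unitS_divide: "u \<in> unitS m \<Longrightarrow> v \<in> unitS m \<Longrightarrow> u / v \<in> (unitS m :: 'a set)"
  by (simp add: unitS_def conj_q_def power_divide)

lemma unitS_inverse: "u \<in> unitS m \<Longrightarrow> inverse u \<in> (unitS m :: 'a set)"
  using unitS_divide[of 1 u] by (simp add: divide_inverse)

text \<open>Such a \<open>u\<close> has the polar forms \<open>u * 1\<close> and
  \<open>1 * u\<close>, and the radius is unique.\<close>

lemma subF_inter_unitS: "u \<in> subF m \<Longrightarrow> u \<in> unitS m \<Longrightarrow> u = (1::'a)"
  using polar_radius_mult[of u 1] polar_radius_mult[of 1 u] by simp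

lemma bij_betw_polar:
  "bij_betw (\<lambda>(t, u). t * u) ((subF m - {0}) \<times> unitS m) (-{0::'a})"
proof (rule bij_betw_byWitness[where f' = "\<lambda>x. (polar_radius x, x / polar_radius x)"])
qed (auto simp: polar_radius_mult polar_radius_in_subF polar_angle_in_unitS unitS_nonzero)

text \<open>The polar bijection gives (q - 1) |S| = q^2 - 1, where q - 1 can be cancelled since q >
  1.\<close>

lemma card_unitS: "card (unitS m :: 'a set) = 2 ^ m + 1"
proof -
  have "(2 ^ m - 1) * card (unitS m :: 'a set) = (2 ^ m)\<^sup>2 - 1"
    using bij_betw_same_card[OF bij_betw_polar]
    by (simp add: card_cartesian_product card_Diff_singleton card_subF Compl_eq_Diff_UNIV card_K)
  also have "\<dots> = (2 ^ m - 1) * (2 ^ m + 1)"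
    by (simp add: power2_eq_square algebra_simps)
  finally have "card (unitS m :: 'a set) = 2 ^ m + 1 \<or> 2 ^ m - 1 = (0::nat)"
    by (simp only: mult_cancel1)
  then show ?thesis using one_less_power[of "2::nat" m] m_pos by auto
qed

lemma polar_cases:
  obtains t u where "t \<in> subF m" "u \<in> unitS m" "(x::'a) = t * u"
proof (cases "x = 0")
  case True
  then show ?thesis using that[of 0 1] by simp
next
  case False
  then show ?thesis
    using that[OF polar_radius_in_subF polar_angle_in_unitS, of x x] by simp
qed

subsection \<open>Trace maps\<close>

text \<open>Squaring permutes the conjugates cyclically, so their sum equals its own square and is 0
  or 1. Hence the description in \<open>abs_trace\<close> denotes.\<close>

lemma of_F2_abs_trace:
  fixes x :: 'a
  assumes "x ^ (2 ^ n) = x"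
  shows "of_F2 (abs_trace n x) = (\<Sum>i<n. x ^ (2 ^ i))"
proof -
  let ?s = "\<Sum>i<n. x ^ (2 ^ i)"
  have "?s ^ 2 = (\<Sum>i<n. (x ^ (2 ^ i)) ^ 2)"
    by (rule freshmans_dream_sum) (simp_all add: CHAR_eq_2)
  also have "\<dots> = (\<Sum>i<n. x ^ (2 ^ Suc i))"
    by (simp add: mult.commute flip: power_mult)
  also have "\<dots> = ?s"
    using sum.lessThan_Suc_shift[of "\<lambda>i. x ^ (2 ^ i)" n] assms by (simp add: add.commute)
  finally have "?s = 0 \<or> ?s = 1" by (simp add: power2_eq_square)
  then obtain c where c: "of_F2 c = ?s" using of_F2_0 of_F2_1 by metis
  then have "abs_trace n x = c"
    unfolding abs_trace_def c[symmetric] by (intro the_equality) simp_all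
  with c show ?thesis by simp
qed

lemma of_F2_abs_trace_subF:
  "x \<in> subF m \<Longrightarrow> of_F2 (abs_trace m x) = (\<Sum>i<m. (x::'a) ^ (2 ^ i))"
  by (rule of_F2_abs_trace) (simp add: subF_def)

lemma of_F2_add: "of_F2 (a + b) = (of_F2 a + of_F2 b :: 'a)"
  by (cases a; cases b) (simp_all add: of_F2_def)

lemma abs_trace_add:
  assumes "x \<in> subF m" "y \<in> subF m"
  shows "abs_trace m (x + y) = abs_trace m x + abs_trace m (y::'a)"
proof -
  have "of_F2 (abs_trace m (x + y)) = (of_F2 (abs_trace m x + abs_trace m y) :: 'a)"
    using assms
    by (simp only: of_F2_add of_F2_abs_trace_subF subF_add power_2_power_add sum.distrib)
  then show ?thesis by (simp only: of_F2_inject)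
qed

lemma abs_trace_0 [simp]: "abs_trace m (0::'a) = 0"
  using abs_trace_add[of 0 0] by simp

text \<open>The 2m conjugates of x split into those of x and those of x^q, since x^(2^(m+i)) =
  (x^q)^(2^i).\<close>

lemma abs_trace_transitive: "abs_trace (2 * m) x = abs_trace m (T m (x::'a))"
proof -
  have "of_F2 (abs_trace (2 * m) x) = (\<Sum>i<m + m. x ^ (2 ^ i))"
    using power_CARD_eq_same[of x] card_K
    by (subst of_F2_abs_trace) (simp_all add: mult_2 power2_eq_square power_add)
  also have "\<dots> = (\<Sum>i<m. x ^ (2 ^ i)) + (\<Sum>i<m. x ^ (2 ^ (m + i)))"
    by (rule sum_lessThan_add)
  also have "\<dots> = (\<Sum>i<m. (T m x) ^ (2 ^ i))"
    by (simp add: T_def conj_q_def power_2_power_add sum.distrib power_add power_mult)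
  also have "\<dots> = of_F2 (abs_trace m (T m x))"
    by (simp add: of_F2_abs_trace_subF T_in_subF)
  finally show ?thesis by simp
qed

text \<open>Otherwise the polynomial X + X^2 + ... + X^(2^(m-1)) would vanish on all q elements of
  F, more than its degree allows.\<close>

lemma abs_trace_surj: "\<exists>a::'a. a \<in> subF m \<and> abs_trace m a = 1"
proof (rule ccontr)
  assume "\<not> ?thesis"
  then have *: "(\<Sum>i<m. a ^ (2 ^ i)) = 0" if "a \<in> subF m" for a :: 'a
    using that of_F2_abs_trace_subF[OF that] by (metis bit_not_one_iff of_F2_0)
  let ?p = "\<Sum>i<m. monom 1 (2 ^ i) :: 'a poly"
  \<comment> \<open>Only the term i = 0 contributes to the coefficient of X, which shows that the
    polynomial is nonzero.\<close>
  have "coeff ?p 1 = (\<Sum>i<m. if i = 0 then 1 else 0)"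
    unfolding coeff_sum by (intro sum.cong) auto
  then have "coeff ?p 1 = 1" using m_pos by simp
  then have "?p \<noteq> 0" by (metis coeff_0 zero_neq_one)
  then have "card {x. poly ?p x = 0} \<le> degree ?p" by (rule card_poly_roots_bound)
  also have "degree ?p \<le> 2 ^ (m - 1)"
    by (intro degree_sum_le) (auto simp: degree_monom_eq)
  also have "\<dots> < 2 ^ m" using m_pos by simp
  also have "2 ^ m \<le> card {x. poly ?p x = 0}"
    unfolding card_subF[symmetric] by (intro card_mono) (auto simp: poly_sum poly_monom *)
  finally show False by simp
qed

text \<open>Orthogonality of additive characters of F: for nonzero \<open>c\<close> a suitable
  translation of \<open>t\<close> negates the sum.\<close>

lemma sum_sign_abs_trace:
  fixes c :: 'a
  assumes "c \<in> subF m"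
  shows "(\<Sum>t\<in>subF m. sign_of (abs_trace m (t * c))) = (if c = 0 then 2 ^ m else 0)"
proof (cases "c = 0")
  case True
  then show ?thesis by (simp add: card_subF)
next
  case False
  obtain a :: 'a where a: "a \<in> subF m" "abs_trace m a = 1" using abs_trace_surj by blast
  let ?s = "\<Sum>t\<in>subF m. sign_of (abs_trace m (t * c))"
  \<comment> \<open>The shift by \<open>a / c\<close> adds tr(a) = 1 to the trace of
    \<open>t * c\<close>, which flips every sign.\<close>
  have "?s = (\<Sum>t\<in>subF m. sign_of (abs_trace m ((t + a / c) * c)))"
    by (rule sum.reindex_bij_witness[of _ "\<lambda>t. t + a / c" "\<lambda>t. t + a / c"])
       (use assms a in \<open>simp_all add: subF_add subF_divide add.assoc\<close>)
  also have "\<dots> = (\<Sum>t\<in>subF m. - sign_of (abs_trace m (t * c)))"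
    by (intro sum.cong refl)
       (use assms a False in \<open>simp add: distrib_right abs_trace_add subF_mult sign_of_add
         del: add_bit_eq_xor\<close>)
  finally show ?thesis using False by (simp add: sum_negf)
qed

subsection \<open>The Walsh transform\<close>

text \<open>Its cardinality is N(b). It collects directions \<open>u\<close> instead of lines; for
  \<open>g\<close> with values in F the two correspond by \<open>inj_on_lineL\<close>.\<close>

definition lines_through :: "('a \<Rightarrow> 'a) \<Rightarrow> 'a \<Rightarrow> 'a set" where
  "lines_through g b = {u \<in> unitS m. b \<in> lineL m u (g u)}"

lemma lineL_iff: "x \<in> lineL m u \<mu> \<longleftrightarrow> T m (u * x) = (\<mu>::'a)"
  by (simp add: lineL_def add_eq_0_iff_eq)

text \<open>On the points \<open>t * u\<close> with \<open>u\<close> fixed the summand is a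
  character of \<open>t\<close> with parameter g(u) + T(u b). Its sum over F is q if b lies on L(u,
  g(u)) and 0 otherwise.\<close>

lemma walsh_eq:
  assumes g: "g \<in> unitS m \<rightarrow> subF m" and f: "defined_from m g f"
  shows "walsh m f b = 2 ^ m * (int (card (lines_through g b)) - 1)"
proof -
  let ?F = "\<lambda>x. sign_of (f x + abs_trace (2 * m) (b * x))"
  let ?c = "\<lambda>u. g u + T m (u * b)"
  have c: "?c u \<in> subF m" if "u \<in> unitS m" for u
    using that g by (auto intro: subF_add T_in_subF)
  have F: "?F (t * u) = sign_of (abs_trace m (t * ?c u))" if "t \<in> subF m" "u \<in> unitS m" for t u
  proof -
    have "f (t * u) = abs_trace m (t * g u)" using f that by (simp add: defined_from_def)
    moreover have "T m (b * (t * u)) = t * T m (u * b)"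
      using T_mult_subF[OF that(1), of "u * b"] by (simp add: mult_ac)
    moreover have "t * g u \<in> subF m" "t * T m (u * b) \<in> subF m"
      using that g by (auto intro: subF_mult T_in_subF)
    ultimately show ?thesis
      by (simp add: abs_trace_transitive abs_trace_add distrib_left del: add_bit_eq_xor)
  qed
  have F0: "?F 0 = 1" using F[of 0 1] by simp
  have "walsh m f b = ?F 0 + sum ?F (-{0})"
    unfolding walsh_def by (subst sum.remove[of _ 0]) (simp_all add: Compl_eq_Diff_UNIV)
  also have "sum ?F (-{0}) = (\<Sum>(t, u)\<in>(subF m - {0}) \<times> unitS m. ?F (t * u))"
    by (subst sum.reindex_bij_betw[OF bij_betw_polar, symmetric]) (simp add: case_prod_beta)
  also have "\<dots> = (\<Sum>u\<in>unitS m. \<Sum>t\<in>subF m - {0}. ?F (t * u))"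
    by (subst sum.swap) (simp add: sum.cartesian_product)
  also have "\<dots> = (\<Sum>u\<in>unitS m. (if ?c u = 0 then 2 ^ m else 0) - 1)"
  proof (intro sum.cong refl)
    fix u :: 'a assume u: "u \<in> unitS m"
    have "(\<Sum>t\<in>subF m - {0}. ?F (t * u)) = (\<Sum>t\<in>subF m. ?F (t * u)) - ?F (0 * u)"
      by (subst sum_diff1) simp_all
    also have "(\<Sum>t\<in>subF m. ?F (t * u)) = (if ?c u = 0 then 2 ^ m else 0)"
      using F[OF _ u] sum_sign_abs_trace[OF c[OF u]] by simp
    finally show "(\<Sum>t\<in>subF m - {0}. ?F (t * u)) = (if ?c u = 0 then 2 ^ m else 0) - 1"
      using F0 by simp
  qed
  \<comment> \<open>Each of the q + 1 directions loses 1 for its omitted point t = 0. The single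
    contribution \<open>F0\<close> of the origin is added back at the end and leaves q N(b) -
    q.\<close>
  also have "\<dots> = 2 ^ m * int (card (lines_through g b)) - (2 ^ m + 1)"
    by (simp add: sum_subtractf card_unitS sum.If_cases lines_through_def lineL_iff add_eq_0_iff_eq
        Int_def eq_commute[of "g _"])
  finally show ?thesis using F0 by (simp add: algebra_simps)
qed

lemma bent_iff_card_lines_through:
  assumes "g \<in> unitS m \<rightarrow> subF m" "defined_from m g f"
  shows "bent m f \<longleftrightarrow> (\<forall>b. card (lines_through g b) \<in> {0, 2})"
proof -
  have "2 ^ m * (int n - 1) = 2 ^ m \<longleftrightarrow> n = 2" "2 ^ m * (int n - 1) = - (2 ^ m) \<longleftrightarrow> n = 0" for n
  proof -
    have "2 ^ m * (int n - 1) = 2 ^ m * 1 \<longleftrightarrow> n = 2"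
      unfolding mult_cancel_left by auto
    moreover have "2 ^ m * (int n - 1) = 2 ^ m * (- 1) \<longleftrightarrow> n = 0"
      unfolding mult_cancel_left by auto
    ultimately show "2 ^ m * (int n - 1) = 2 ^ m \<longleftrightarrow> n = 2"
      "2 ^ m * (int n - 1) = - (2 ^ m) \<longleftrightarrow> n = 0" by simp_all
  qed
  then show ?thesis by (auto simp: bent_def walsh_eq[OF assms])
qed

text \<open>N(b) = 2 gives the Walsh value q, hence dual value 0; N(b) = 0 gives -q, hence 1. The
  description in \<open>dual\<close> denotes because \<open>sign_of\<close> is injective.\<close>

lemma dual_eq:
  assumes "g \<in> unitS m \<rightarrow> subF m" "defined_from m g f" "bent m f"
  shows "dual m f b = (if lines_through g b = {} then 1 else 0)"
proof -
  have "card (lines_through g b) \<in> {0, 2}"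
    using assms(3) unfolding bent_iff_card_lines_through[OF assms(1,2)] by blast
  then have "walsh m f b = sign_of (if lines_through g b = {} then 1 else 0) * 2 ^ m"
    by (auto simp: walsh_eq[OF assms(1,2)])
  moreover have "c = d" if "sign_of c * 2 ^ m = sign_of d * 2 ^ m" for c d
    using that by (cases c; cases d) (simp_all add: sign_of_def)
  ultimately show ?thesis unfolding dual_def by (intro the_equality) simp_all
qed

lemma in_covered_iff:
  "x \<in> covered {lineL m u (g u) | u. u \<in> unitS m} \<longleftrightarrow> lines_through g x \<noteq> {}"
  by (auto simp: covered_def lines_through_def)

subsection \<open>Lines and line ovals\<close>

text \<open>The map x -> (T(u x), T(v x)) from K to F x F is injective, and both sides have q^2
  elements, so it is a bijection.\<close>

lemma lineL_inter_ex1: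
  fixes u v :: 'a
  assumes uv: "u \<in> unitS m" "v \<in> unitS m" "u \<noteq> v" and "\<mu> \<in> subF m" "\<nu> \<in> subF m"
  shows "\<exists>!x. x \<in> lineL m u \<mu> \<and> x \<in> lineL m v \<nu>"
proof -
  let ?h = "\<lambda>x. (T m (u * x), T m (v * x))"
  have "x = y" if "?h x = ?h y" for x y
  proof (rule ccontr)
    assume "x \<noteq> y"
    then have z: "x + y \<noteq> 0" by (simp add: add_eq_0_iff_eq)
    have "T m (u * (x + y)) = 0" "T m (v * (x + y)) = 0"
      using that by (simp_all add: distrib_left T_add)
    \<comment> \<open>A nonzero z in the kernel would have u z and v z in F, so their quotient u / v
      would lie in both F and S.\<close>
    then have "u * (x + y) / (v * (x + y)) \<in> subF m"
      by (intro subF_divide) (simp_all only: T_eq_0_iff)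
    then have "u / v = 1" using uv z by (intro subF_inter_unitS unitS_divide) simp_all
    then show False using uv by simp
  qed
  then have inj: "inj ?h" by (rule injI)
  have "range ?h = subF m \<times> subF m"
  proof (rule card_subset_eq)
    show "card (range ?h) = card (subF m \<times> subF m :: ('a \<times> 'a) set)"
      using inj by (simp add: card_image card_K card_cartesian_product card_subF power2_eq_square)
  qed (auto simp: T_in_subF)
  then have "(\<mu>, \<nu>) \<in> range ?h" using assms by simp
  then obtain x where x: "?h x = (\<mu>, \<nu>)" by (elim rangeE) (simp only:)
  show ?thesis
  proof (rule ex1I)
    show "x \<in> lineL m u \<mu> \<and> x \<in> lineL m v \<nu>" using x by (simp add: lineL_iff)
    show "y = x" if "y \<in> lineL m u \<mu> \<and> y \<in> lineL m v \<nu>" for y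
      using that x by (intro injD[OF inj]) (simp add: lineL_iff)
  qed
qed

section \<open>The lines of AG(2,q) as the sets L(u, \<mu>)\<close>

text \<open>A point x lies on the line through \<open>a\<close> iff u (x - a) is in the kernel F of
  T, that is, iff x - a is an F-multiple of 1/u.\<close>

lemma lineL_eq:
  fixes u a :: 'a
  assumes "u \<in> unitS m"
  shows "lineL m u (T m (u * a)) = (\<lambda>t. a + t * inverse u) ` subF m"
proof (intro set_eqI iffI)
  fix x assume "x \<in> lineL m u (T m (u * a))"
  then have "u * a + u * x \<in> subF m" by (simp add: lineL_iff T_add flip: T_eq_0_iff)
  moreover have "x = a + (u * a + u * x) * inverse u"
    using unitS_nonzero[OF assms] by (simp add: field_simps flip: add.assoc)
  ultimately show "x \<in> (\<lambda>t. a + t * inverse u) ` subF m" by (rule rev_image_eqI)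
next
  fix x assume "x \<in> (\<lambda>t. a + t * inverse u) ` subF m"
  then obtain t where "t \<in> subF m" "x = a + t * inverse u" by blast
  moreover have "u * (t * inverse u) = t" using unitS_nonzero[OF assms] by simp
  ultimately show "x \<in> lineL m u (T m (u * a))"
    by (simp only: lineL_iff T_add distrib_left T_eq_0_iff[THEN iffD2] add_0_right)
qed

lemma lineL_param:
  assumes "u \<in> unitS m" "\<mu> \<in> subF m"
  obtains a :: 'a where "T m (u * a) = \<mu>" "lineL m u \<mu> = (\<lambda>t. a + t * inverse u) ` subF m"
proof -
  obtain b where "T m b = \<mu>" using assms(2) range_T by (metis rangeE)
  then have "T m (u * (b / u)) = \<mu>" using unitS_nonzero[OF assms(1)] by simp
  with that lineL_eq[OF assms(1)] show thesis by metis
qed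

lemma card_lineL:
  assumes "u \<in> unitS m" "\<mu> \<in> subF m"
  shows "card (lineL m u (\<mu>::'a)) = 2 ^ m"
proof -
  obtain a where "lineL m u \<mu> = (\<lambda>t. a + t * inverse u) ` subF m"
    using lineL_param[OF assms] by metis
  moreover have "inj_on (\<lambda>t. a + t * inverse u) (subF m)"
    using unitS_nonzero[OF assms(1)] by (simp add: inj_on_def)
  ultimately show ?thesis by (simp add: card_image card_subF)
qed

text \<open>Only the angle of a direction vector d = s w matters, since multiplication by the
  nonzero s maps F onto itself. The corresponding \<open>u\<close> is the inverse of w.\<close>

lemma ag_lines_eq: "ag_lines m = {lineL m u \<mu> | u \<mu>. u \<in> unitS m \<and> \<mu> \<in> (subF m :: 'a set)}"
proof (intro set_eqI iffI)
  fix l :: "'a set" assume "l \<in> ag_lines m"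
  then obtain a d where d: "d \<noteq> 0" and l: "l = {a + t * d | t. t \<in> subF m}"
    by (auto simp: ag_lines_def)
  obtain s w where s: "s \<in> subF m" and w: "w \<in> unitS m" and sw: "d = s * w"
    by (rule polar_cases[of d])
  have s0: "s \<noteq> 0" using d sw by auto
  have "l = (\<lambda>t. a + t * w) ` ((\<lambda>t. t * s) ` subF m)"
    unfolding l sw by (auto simp: mult.assoc)
  also have "(\<lambda>t. t * s) ` subF m = subF m"
    using s s0 by (auto simp: subF_mult subF_divide intro!: image_eqI[where x = "_ / s"])
  finally have "l = lineL m (inverse w) (T m (inverse w * a))"
    using lineL_eq[OF unitS_inverse[OF w]] by simp
  then show "l \<in> {lineL m u \<mu> | u \<mu>. u \<in> unitS m \<and> \<mu> \<in> subF m}"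
    using unitS_inverse[OF w] T_in_subF by blast
next
  fix l assume "l \<in> {lineL m u \<mu> | u \<mu>. u \<in> unitS m \<and> \<mu> \<in> (subF m :: 'a set)}"
  then obtain u \<mu> where u: "u \<in> unitS m" and \<mu>: "\<mu> \<in> subF m" and l: "l = lineL m u \<mu>" by blast
  obtain a where "l = (\<lambda>t. a + t * inverse u) ` subF m" using lineL_param[OF u \<mu>] l by metis
  moreover have "inverse u \<noteq> 0" using unitS_nonzero[OF u] by simp
  ultimately show "l \<in> ag_lines m" unfolding ag_lines_def by blast
qed

text \<open>For \<open>u = v\<close> both lines are level sets of the same function. Otherwise they
  share exactly one point, so parallelism would make them equal and leave a line with one point
  instead of q > 1.\<close>

lemma parallel_lineL_iff:
  assumes "u \<in> unitS m" "v \<in> unitS m" "\<mu> \<in> subF m" "\<nu> \<in> (subF m :: 'a set)"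
  shows "parallel (lineL m u \<mu>) (lineL m v \<nu>) \<longleftrightarrow> u = v"
proof
  assume "u = v"
  then show "parallel (lineL m u \<mu>) (lineL m v \<nu>)" by (auto simp: parallel_def lineL_iff)
next
  assume par: "parallel (lineL m u \<mu>) (lineL m v \<nu>)"
  show "u = v"
  proof (rule ccontr)
    assume "u \<noteq> v"
    then obtain x where x: "lineL m u \<mu> \<inter> lineL m v \<nu> = {x}"
      using lineL_inter_ex1[OF assms(1,2) _ assms(3,4)] by blast
    then have "card (lineL m u \<mu>) = 1" using par by (auto simp: parallel_def)
    then show False using assms m_pos by (simp add: card_lineL)
  qed
qed

section \<open>Line ovals given by functions on S\<close>

lemma inj_on_lineL:
  assumes "g \<in> unitS m \<rightarrow> (subF m :: 'a set)"
  shows "inj_on (\<lambda>u. lineL m u (g u)) (unitS m)"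
proof (rule inj_onI)
  fix u v assume uv: "u \<in> unitS m" "v \<in> unitS m" and "lineL m u (g u) = lineL m v (g v)"
  then have "parallel (lineL m u (g u)) (lineL m v (g v))" by (simp add: parallel_def)
  then show "u = v" using parallel_lineL_iff[OF uv] assms uv by blast
qed

text \<open>
  A line \<open>L\<close> of the oval has \<open>q\<close> points, and the \<open>q\<close> other lines of the oval meet it in distinct
  points. So every point of \<open>L\<close> lies on another line of the oval.
\<close>

lemma line_oval_card_lines_through:
  assumes g: "g \<in> unitS m \<rightarrow> (subF m :: 'a set)"
    and oval: "line_oval m {lineL m u (g u) | u. u \<in> unitS m}"
  shows "card (lines_through g b) \<in> {0, 2}"
proof (cases "lines_through g b = {}")
  case False
  then obtain u where u: "u \<in> unitS m" and bu: "b \<in> lineL m u (g u)"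
    by (auto simp: lines_through_def)
  have gF: "g v \<in> subF m" if "v \<in> unitS m" for v using g that by auto
  have no3: False
    if "u1 \<in> unitS m" "u2 \<in> unitS m" "u3 \<in> unitS m" "u1 \<noteq> u2" "u1 \<noteq> u3" "u2 \<noteq> u3"
      "x \<in> lineL m u1 (g u1)" "x \<in> lineL m u2 (g u2)" "x \<in> lineL m u3 (g u3)" for u1 u2 u3 x
  proof -
    let ?l1 = "lineL m u1 (g u1)" and ?l2 = "lineL m u2 (g u2)" and ?l3 = "lineL m u3 (g u3)"
    have "?l1 \<noteq> ?l2" "?l1 \<noteq> ?l3" "?l2 \<noteq> ?l3"
      using that inj_onD[OF inj_on_lineL[OF g]] by metis+
    with oval that show False unfolding line_oval_def by blast
  qed
  \<comment> \<open>The point where the line with direction \<open>v\<close> meets the fixed line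
    through \<open>b\<close>.\<close>
  define p where "p v = (THE x. x \<in> lineL m u (g u) \<and> x \<in> lineL m v (g v))" for v
  have p: "p v \<in> lineL m u (g u)" "p v \<in> lineL m v (g v)" if "v \<in> unitS m - {u}" for v
  proof -
    have "\<exists>!x. x \<in> lineL m u (g u) \<and> x \<in> lineL m v (g v)"
      using that u gF by (intro lineL_inter_ex1) auto
    from theI'[OF this] show "p v \<in> lineL m u (g u)" "p v \<in> lineL m v (g v)"
      by (simp_all add: p_def)
  qed
  \<comment> \<open>If \<open>p v = p w\<close> with distinct \<open>v\<close> and \<open>w\<close>,
    three lines of the oval would pass through this point.\<close>
  have "inj_on p (unitS m - {u})"
  proof (rule inj_onI, rule ccontr)
    fix v w assume vw: "v \<in> unitS m - {u}" "w \<in> unitS m - {u}" "p v = p w" "v \<noteq> w"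
    then show False
      using no3[of u v w "p v"] p[of v] p[of w] u by auto
  qed
  then have "card (p ` (unitS m - {u})) = 2 ^ m"
    using u by (simp add: card_image card_Diff_singleton card_unitS)
  then have "p ` (unitS m - {u}) = lineL m u (g u)"
    using p by (intro card_subset_eq) (auto simp: card_lineL[OF u gF[OF u]])
  then obtain v where v: "v \<in> unitS m" "v \<noteq> u" "b = p v" using bu by blast
  \<comment> \<open>The lines of \<open>u\<close> and \<open>v\<close> pass through
    \<open>b\<close>, and a third one is excluded by \<open>no3\<close>.\<close>
  then have "lines_through g b = {u, v}"
    using u bu p[of v] no3[of u v _ b] by (auto simp: lines_through_def)
  then show ?thesis using v by simp
qed simp

text \<open>Three concurrent lines would put three distinct directions into
  \<open>lines_through g x\<close>. The other conditions hold because the q + 1 lines have pairwise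
  different directions.\<close>

lemma line_oval_of_card_lines_through:
  assumes g: "g \<in> unitS m \<rightarrow> (subF m :: 'a set)"
    and N: "\<And>b. card (lines_through g b) \<in> {0, 2}"
  shows "line_oval m {lineL m u (g u) | u. u \<in> unitS m}"
proof -
  let ?Ov = "{lineL m u (g u) | u. u \<in> unitS m}"
  have img: "?Ov = (\<lambda>u. lineL m u (g u)) ` unitS m" by blast
  have gF: "g v \<in> subF m" if "v \<in> unitS m" for v using g that by auto
  have "?Ov \<subseteq> ag_lines m" unfolding ag_lines_eq using gF by blast
  moreover have "card ?Ov = 2 ^ m + 1"
    unfolding img by (simp add: card_image inj_on_lineL[OF g] card_unitS)
  moreover have "\<not> parallel l l'" if ll: "l \<in> ?Ov" "l' \<in> ?Ov" "l \<noteq> l'" for l l'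
  proof -
    obtain u v where "u \<in> unitS m" "v \<in> unitS m" "l = lineL m u (g u)" "l' = lineL m v (g v)"
      using ll by blast
    with ll(3) show ?thesis using parallel_lineL_iff gF by metis
  qed
  moreover have False
    if l: "l1 \<in> ?Ov" "l2 \<in> ?Ov" "l3 \<in> ?Ov" "l1 \<noteq> l2" "l1 \<noteq> l3" "l2 \<noteq> l3"
      and x: "x \<in> l1" "x \<in> l2" "x \<in> l3" for l1 l2 l3 x
  proof -
    obtain u1 u2 u3 where u: "u1 \<in> unitS m" "u2 \<in> unitS m" "u3 \<in> unitS m"
      "l1 = lineL m u1 (g u1)" "l2 = lineL m u2 (g u2)" "l3 = lineL m u3 (g u3)"
      using l by blast
    then have "{u1, u2, u3} \<subseteq> lines_through g x" using x by (auto simp: lines_through_def)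
    then have "card {u1, u2, u3} \<le> card (lines_through g x)" by (intro card_mono) simp_all
    moreover have "u1 \<noteq> u2" "u1 \<noteq> u3" "u2 \<noteq> u3" using u l(4-6) by metis+
    then have "card {u1, u2, u3} = 3" by simp
    ultimately show False using N[of x] by auto
  qed
  ultimately show ?thesis by (rule line_ovalI)
qed

lemma bent_iff_line_oval:
  assumes "g \<in> unitS m \<rightarrow> subF m" "defined_from m g f"
  shows "bent m f \<longleftrightarrow> line_oval m {lineL m u (g u) | u. u \<in> (unitS m :: 'a set)}"
  unfolding bent_iff_card_lines_through[OF assms]
  using line_oval_card_lines_through[OF assms(1)] line_oval_of_card_lines_through[OF assms(1)]
  by (intro iffI allI) simp_all

section \<open>Recovering g from a line oval and f from g\<close>

text \<open>Lines of the oval are pairwise non-parallel, so their directions differ; q + 1 lines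
  then use each of the q + 1 directions once. The value g(u) is the constant of the line with
  direction u.\<close>

lemma line_oval_param:
  assumes oval: "line_oval m (Ov :: 'a set set)"
  obtains g where "g \<in> unitS m \<rightarrow> subF m" "Ov = {lineL m u (g u) | u. u \<in> unitS m}"
proof -
  have Ov: "Ov \<subseteq> ag_lines m" "card Ov = 2 ^ m + 1"
    and np: "\<And>l l'. l \<in> Ov \<Longrightarrow> l' \<in> Ov \<Longrightarrow> l \<noteq> l' \<Longrightarrow> \<not> parallel l l'"
    using oval by (auto simp: line_oval_def)
  have "\<forall>l\<in>Ov. \<exists>u. u \<in> unitS m \<and> (\<exists>\<mu>\<in>subF m. l = lineL m u \<mu>)"
    using Ov(1) unfolding ag_lines_eq by blast
  then obtain dir
    where dir: "\<And>l. l \<in> Ov \<Longrightarrow> dir l \<in> unitS m \<and> (\<exists>\<mu>\<in>subF m. l = lineL m (dir l) \<mu>)"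
    by (auto dest!: bchoice)
  have "inj_on dir Ov"
  proof (rule inj_onI, rule ccontr)
    fix l l' assume "l \<in> Ov" "l' \<in> Ov" "dir l = dir l'" "l \<noteq> l'"
    then show False using np[of l l'] dir[of l] dir[of l'] parallel_lineL_iff by metis
  qed
  then have "dir ` Ov = unitS m"
    using dir by (intro card_subset_eq) (auto simp: card_image Ov(2) card_unitS)
  then have "\<forall>u\<in>unitS m. \<exists>\<mu>. \<mu> \<in> subF m \<and> lineL m u \<mu> \<in> Ov"
    using dir by (metis imageE)
  then obtain g where g: "\<And>u. u \<in> unitS m \<Longrightarrow> g u \<in> subF m \<and> lineL m u (g u) \<in> Ov"
    by (auto dest!: bchoice)
  then have gF: "g \<in> unitS m \<rightarrow> subF m" by blast
  \<comment> \<open>The image lies in \<open>Ov\<close> and has the same cardinality q + 1.\<close>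
  have "(\<lambda>u. lineL m u (g u)) ` unitS m = Ov"
    using g Ov(2)
    by (intro card_subset_eq) (auto simp: card_image inj_on_lineL[OF gF] card_unitS)
  then have "Ov = {lineL m u (g u) | u. u \<in> unitS m}" by blast
  with gF that show thesis by blast
qed

lemma ex1_defined_from: "\<exists>!f. defined_from m (g :: 'a \<Rightarrow> 'a) f"
proof (rule ex_ex1I)
  \<comment> \<open>For \<open>t = 0\<close> the argument of \<open>g\<close> is 0 / 0 = 0 and not
    an angle, but the factor \<open>polar_radius 0 = 0\<close> makes both sides vanish.\<close>
  have "polar_radius (t * u) * g (t * u / polar_radius (t * u)) = t * g u"
    if "t \<in> subF m" "u \<in> unitS m" for t u
    using polar_radius_mult[OF that] by (cases "t = 0") simp_all
  then have "defined_from m g (\<lambda>x. abs_trace m (polar_radius x * g (x / polar_radius x)))"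
    by (simp add: defined_from_def)
  then show "\<exists>f. defined_from m g f" by blast
next
  fix f f' assume ff': "defined_from m g f" "defined_from m g f'"
  show "f = f'"
  proof
    fix x :: 'a
    obtain t u where "t \<in> subF m" "u \<in> unitS m" "x = t * u" by (rule polar_cases[of x])
    with ff' show "f x = f' x" by (simp add: defined_from_def)
  qed
qed

text \<open>On uF the function is t -> tr(t g(u)), which is additive; the only scalars are 0 and
  1.\<close>

lemma defined_from_linear:
  assumes g: "g \<in> unitS m \<rightarrow> subF m" and f: "defined_from m g f" and u: "u \<in> (unitS m :: 'a set)"
  shows "F2_linear_on {u * t | t. t \<in> subF m} f"
proof -
  have fu: "f (u * t) = abs_trace m (t * g u)" if "t \<in> subF m" for t
    using f u that by (metis defined_from_def mult.commute)
  have gu: "g u \<in> subF m" using g u by auto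
  have "f (u * t + u * s) = f (u * t) + f (u * s)" if "t \<in> subF m" "s \<in> subF m" for t s
    using fu[OF subF_add[OF that]] fu that gu
    by (simp add: distrib_left distrib_right abs_trace_add subF_mult del: add_bit_eq_xor)
  moreover have "f (of_F2 c * (u * t)) = c * f (u * t)" if "t \<in> subF m" for c t
    using fu[of 0] by (cases c) simp_all
  ultimately show ?thesis unfolding F2_linear_on_def by blast
qed

end

theorem theorem3p1:
  fixes m :: nat
  assumes "m \<ge> 1"
    and "CARD('a::{field,finite}) = (2 ^ m)\<^sup>2"
  shows
    "(\<forall>g \<in> unitS m \<rightarrow> subF m. \<forall>f :: 'a \<Rightarrow> bit. defined_from m g f \<longrightarrow>
        (let Ov = {lineL m u (g u) | u. u \<in> unitS m} in
          (bent m f \<longleftrightarrow> line_oval m Ov) \<and>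
          (bent m f \<longrightarrow>
             (\<forall>x. dual m f x = 1 + indicator (covered Ov) x) \<and>
             (\<forall>x \<in> covered Ov. dual m f x = 0) \<and>
             (\<forall>x. x \<notin> covered Ov \<longrightarrow> dual m f x = 1))))
     \<and>
     (\<forall>Ov :: 'a set set. line_oval m Ov \<longrightarrow>
        (\<exists>g \<in> unitS m \<rightarrow> subF m.
           Ov = {lineL m u (g u) | u. u \<in> unitS m} \<and>
           (\<exists>!f. defined_from m g f) \<and>
           (\<forall>f. defined_from m g f \<longrightarrow>
              bent m f \<and> (\<forall>u \<in> unitS m. F2_linear_on {u * t | t. t \<in> subF m} f))))"
proof (intro conjI ballI allI impI)
  fix g :: "'a \<Rightarrow> 'a" and f
  assume gf: "g \<in> unitS m \<rightarrow> subF m" "defined_from m g f"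
  let ?Ov = "{lineL m u (g u) | u. u \<in> unitS m}"
  \<comment> \<open>Being covered means N(x) > 0. Since 1 + 1 = 0 in \<open>bit\<close>, all three
    descriptions of the dual follow from this one.\<close>
  have "dual m f x = (if x \<in> covered ?Ov then 0 else 1)" if "bent m f" for x
    using dual_eq[OF assms gf that] by (simp add: in_covered_iff[OF assms])
  then show "let Ov = ?Ov in
      (bent m f \<longleftrightarrow> line_oval m Ov) \<and>
      (bent m f \<longrightarrow>
         (\<forall>x. dual m f x = 1 + indicator (covered Ov) x) \<and>
         (\<forall>x \<in> covered Ov. dual m f x = 0) \<and>
         (\<forall>x. x \<notin> covered Ov \<longrightarrow> dual m f x = 1))"
    unfolding Let_def bent_iff_line_oval[OF assms gf] by (simp add: indicator_def)
next
  fix Ov :: "'a set set"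
  assume oval: "line_oval m Ov"
  obtain g where g: "g \<in> unitS m \<rightarrow> subF m" and Ov: "Ov = {lineL m u (g u) | u. u \<in> unitS m}"
    using line_oval_param[OF assms oval] by blast
  have "bent m f \<and> (\<forall>u \<in> unitS m. F2_linear_on {u * t | t. t \<in> subF m} f)"
    if "defined_from m g f" for f
    using bent_iff_line_oval[OF assms g that] oval defined_from_linear[OF assms g that]
    unfolding Ov by blast
  with Ov ex1_defined_from[OF assms]
  have "Ov = {lineL m u (g u) | u. u \<in> unitS m} \<and> (\<exists>!f. defined_from m g f) \<and>
      (\<forall>f. defined_from m g f \<longrightarrow>
         bent m f \<and> (\<forall>u \<in> unitS m. F2_linear_on {u * t | t. t \<in> subF m} f))"
    by (intro conjI allI impI) simp_all
  then show "\<exists>g \<in> unitS m \<rightarrow> subF m.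
           Ov = {lineL m u (g u) | u. u \<in> unitS m} \<and>
           (\<exists>!f. defined_from m g f) \<and>
           (\<forall>f. defined_from m g f \<longrightarrow>
              bent m f \<and> (\<forall>u \<in> unitS m. F2_linear_on {u * t | t. t \<in> subF m} f))"
    using g by (rule bexI)
qed

end
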